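(* Let $K\ge1$ and let $Q$ be the symmetric $4(K+1)\times4(K+1)$ data matrix of the truncated least squares rotation problem defined in the context. Let $Z^\star$ be the optimal solution of the semidefinite program $$\min_{Z\succeq0}\ \mathrm{tr}(QZ)\quad\text{s.t.}\quad \mathrm{tr}([Z]_{00})=1,\quad [Z]_{kk}=[Z]_{00}\ (k=1,\dots,K),\quad [Z]_{ij}=[Z]_{ij}^{\mathsf T}\ (0\le i<j\le K),\tag{SDP}$$ where $Z$ is a symmetric $4(K+1)\times4(K+1)$ matrix. If $\mathrm{rank}(Z^\star)=1$ (the relaxation is then said to be tight), then: 1. the optimal cost of (SDP) equals the optimal cost of the quadratically constrained quadratic program $$\min_{x\in\mathbb{R}^{4(K+1)}}x^{\mathsf T}Qx\quad\text{s.t.}\quad x_q^{\mathsf T}x_q=1,\quad x_{q_k}x_{q_k}^{\mathsf T}=x_qx_q^{\mathsf T},\ k=1,\dots,K;\tag{QCQP}$$ 2. $Z^\star$ can be written as $Z^\star=x^\star(x^\star)^{\mathsf T}$, where $x^\star=[(q^\star)^{\mathsf T},(q_1^\star)^{\mathsf T},\dots,(q_K^\star)^{\mathsf T}]^{\mathsf T}$ with $q_k^\star=\theta_k^\star q^\star$, $\theta_k^\star\in\{\pm1\}$; 3. $\pm x^\star$ are the two unique global minimizers of (QCQP).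
   Context: **Blocks.** A vector $x\in\mathbb{R}^{4(K+1)}$ is partitioned as $x=[x_q^{\mathsf T},x_{q_1}^{\mathsf T},\dots,x_{q_K}^{\mathsf T}]^{\mathsf T}$ with blocks in $\mathbb{R}^4$. A $4(K+1)\times4(K+1)$ matrix $M$ is partitioned into $4\times4$ blocks $[M]_{ij}$, $0\le i,j\le K$. **Data matrix $Q$.** Data: $\bar a_k,\bar b_k\in\mathbb{R}^3$, $\delta_k>0$ ($k=1,\dots,K$), $\hat s>0$, $\bar c>0$. Put $\hat a_k=[\hat s\bar a_k^{\mathsf T}\ 0]^{\mathsf T}$, $\hat b_k=[\bar b_k^{\mathsf T}\ 0]^{\mathsf T}\in\mathbb{R}^4$. For $q=[q_1\, q_2\, q_3\, q_4]^{\mathsf T}\in\mathbb{R}^4$ let $$\Omega_1(q)=\begin{bmatrix} q_4 & -q_3 & q_2 & q_1 \\ q_3 & q_4 & -q_1 & q_2 \\ -q_2 & q_1 & q_4 & q_3 \\ -q_1 & -q_2 & -q_3 & q_4 \end{bmatrix},\quad \Omega_2(q)=\begin{bmatrix} q_4 & q_3 & -q_2 & q_1 \\ -q_3 & q_4 & q_1 & q_2 \\ q_2 & -q_1 & q_4 & q_3 \\ -q_1 & -q_2 & -q_3 & q_4 \end{bmatrix}.$$ Then $[Q]_{00}=0$, $$[Q]_{kk}=\frac{(\|\hat b_k\|^2+\|\hat a_k\|^2)I_4+2\Omega_1(\hat b_k)\Omega_2(\hat a_k)}{2\delta_k^2}+\frac{\bar c^2}{2}I_4,$$ $$[Q]_{0k}=[Q]_{k0}=\frac{(\|\hat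 b_k\|^2+\|\hat a_k\|^2)I_4+2\Omega_1(\hat b_k)\Omega_2(\hat a_k)}{4\delta_k^2}-\frac{\bar c^2}{4}I_4$$ for $k=1,\dots,K$, and all other blocks are zero. (QCQP) is equivalent to the problem $\min_{R\in SO(3)}\sum_k\min(\|\bar b_k-\hat sR\bar a_k\|^2/\delta_k^2,\bar c^2)$ with $R$ parametrized by a unit quaternion $q$ and $q_k=\pm q$ encoding whether measurement $k$ is an inlier ($+$) or outlier ($-$). *)

theory Defs
  imports "HOL-Analysis.Analysis"
begin

text \<open>
  The type \<^typ>\<open>'k\<close> indexes the measurements, so K is \<open>CARD('k)\<close>, which is at least 1.
  Blocks are indexed by \<^typ>\<open>'k option\<close>: \<^const>\<open>None\<close> is block 0 and \<^term>\<open>Some k\<close> is the block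
  of measurement \<open>k\<close>. Block vectors are thus elements of R^(4(K+1)).
\<close>

type_synonym 'k block_vec = "real ^ ('k option \<times> 4)"
type_synonym 'k block_mat = "real ^ ('k option \<times> 4) ^ ('k option \<times> 4)"

definition vblk :: "'k::finite block_vec \<Rightarrow> 'k option \<Rightarrow> real^4" where
  "vblk x i = (\<chi> r. x $ (i, r))"

definition mblk :: "'k::finite block_mat \<Rightarrow> 'k option \<Rightarrow> 'k option \<Rightarrow> real^4^4" where
  "mblk M i j = (\<chi> r s. M $ (i, r) $ (j, s))"

definition outer :: "real^'n \<Rightarrow> real^'m \<Rightarrow> real^'m^'n" where
  "outer x y = (\<chi> i j. x $ i * y $ j)"

definition pos_semidef :: "real^'n^'n \<Rightarrow> bool" where
  "pos_semidef M \<longleftrightarrow> transpose M = M \<and> (\<forall>x. 0 \<le> x \<bullet> (M *v x))"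

definition Omega1 :: "real^4 \<Rightarrow> real^4^4" where
  "Omega1 q = vector
    [vector [q$4, - q$3, q$2, q$1],
     vector [q$3, q$4, - q$1, q$2],
     vector [- q$2, q$1, q$4, q$3],
     vector [- q$1, - q$2, - q$3, q$4]]"

definition Omega2 :: "real^4 \<Rightarrow> real^4^4" where
  "Omega2 q = vector
    [vector [q$4, q$3, - q$2, q$1],
     vector [- q$3, q$4, q$1, q$2],
     vector [q$2, - q$1, q$4, q$3],
     vector [- q$1, - q$2, - q$3, q$4]]"

definition pad :: "real^3 \<Rightarrow> real^4" where
  "pad v = vector [v$1, v$2, v$3, 0]"

definition residual_mat :: "('k \<Rightarrow> real^3) \<Rightarrow> ('k \<Rightarrow> real^3) \<Rightarrow> real \<Rightarrow> 'k \<Rightarrow> real^4^4" where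
  "residual_mat a b s k =
     (let a' = pad (s *\<^sub>R a k); b' = pad (b k)
      in ((norm b')\<^sup>2 + (norm a')\<^sup>2) *\<^sub>R mat 1 + 2 *\<^sub>R (Omega1 b' ** Omega2 a'))"

fun data_block :: "('k \<Rightarrow> real^3) \<Rightarrow> ('k \<Rightarrow> real^3) \<Rightarrow> ('k \<Rightarrow> real) \<Rightarrow> real \<Rightarrow> real
    \<Rightarrow> 'k option \<Rightarrow> 'k option \<Rightarrow> real^4^4" where
  "data_block a b \<delta> s c None None = 0"
| "data_block a b \<delta> s c None (Some k) =
     (1 / (4 * (\<delta> k)\<^sup>2)) *\<^sub>R residual_mat a b s k - (c\<^sup>2 / 4) *\<^sub>R mat 1"
| "data_block a b \<delta> s c (Some k) None =
     (1 / (4 * (\<delta> k)\<^sup>2)) *\<^sub>R residual_mat a b s k - (c\<^sup>2 / 4) *\<^sub>R mat 1"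
| "data_block a b \<delta> s c (Some k) (Some l) =
     (if k = l
      then (1 / (2 * (\<delta> k)\<^sup>2)) *\<^sub>R residual_mat a b s k + (c\<^sup>2 / 2) *\<^sub>R mat 1
      else 0)"

definition data_matrix :: "('k::finite \<Rightarrow> real^3) \<Rightarrow> ('k \<Rightarrow> real^3) \<Rightarrow> ('k \<Rightarrow> real) \<Rightarrow> real \<Rightarrow> real
    \<Rightarrow> 'k block_mat" where
  "data_matrix a b \<delta> s c = (\<chi> u v. data_block a b \<delta> s c (fst u) (fst v) $ snd u $ snd v)"

text \<open>
  The off-diagonal symmetry constraints are imposed for all \<open>i \<noteq> j\<close>, as block labels carry no
  order. Since \<open>Z\<close> is symmetric, its \<open>(j, i)\<close> block is the transpose of its \<open>(i, j)\<close> block, so this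
  is the same as imposing them for \<open>i < j\<close> in any enumeration of the blocks.
\<close>

definition sdp_feasible :: "'k::finite block_mat \<Rightarrow> bool" where
  "sdp_feasible Z \<longleftrightarrow>
     pos_semidef Z \<and>
     trace (mblk Z None None) = 1 \<and>
     (\<forall>k. mblk Z (Some k) (Some k) = mblk Z None None) \<and>
     (\<forall>i j. i \<noteq> j \<longrightarrow> mblk Z i j = transpose (mblk Z i j))"

definition sdp_cost :: "'k::finite block_mat \<Rightarrow> 'k block_mat \<Rightarrow> real" where
  "sdp_cost Q Z = trace (Q ** Z)"

definition qcqp_feasible :: "'k::finite block_vec \<Rightarrow> bool" where
  "qcqp_feasible x \<longleftrightarrow>
     vblk x None \<bullet> vblk x None = 1 \<and>
     (\<forall>k. outer (vblk x (Some k)) (vblk x (Some k)) = outer (vblk x None) (vblk x None))"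

definition qcqp_cost :: "'k::finite block_mat \<Rightarrow> 'k block_vec \<Rightarrow> real" where
  "qcqp_cost Q x = x \<bullet> (Q *v x)"

text \<open>Optimal costs are infima in the extended reals, so they are meaningful unconditionally.\<close>

definition sdp_value :: "'k::finite block_mat \<Rightarrow> ereal" where
  "sdp_value Q = (INF Z\<in>{Z. sdp_feasible Z}. ereal (sdp_cost Q Z))"

definition qcqp_value :: "'k::finite block_mat \<Rightarrow> ereal" where
  "qcqp_value Q = (INF x\<in>{x. qcqp_feasible x}. ereal (qcqp_cost Q x))"

abbreviation sdp_optimal :: "'k::finite block_mat \<Rightarrow> 'k block_mat \<Rightarrow> bool" where
  "sdp_optimal Q \<equiv> is_arg_min (sdp_cost Q) sdp_feasible"

abbreviation qcqp_optimal :: "'k::finite block_mat \<Rightarrow> 'k block_vec \<Rightarrow> bool" where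
  "qcqp_optimal Q \<equiv> is_arg_min (qcqp_cost Q) qcqp_feasible"

end

theory Submission
  imports Defs
begin

text \<open>
  The map \<open>x \<mapsto> x x\<^sup>T\<close> identifies the feasible points of (QCQP), up to sign, with the feasible points
  of (SDP) of the form \<open>x x\<^sup>T\<close>, and preserves the cost. A symmetric rank-one matrix with positive
  trace has this form, so a rank-one optimum of (SDP) comes from an optimum of (QCQP). Every
  minimizer of (QCQP) in turn gives an optimum of (SDP), whence uniqueness up to sign.
\<close>

text \<open>The diagonal fixes each entry up to sign; once the sign is known at one nonzero entry
  \<open>w $ p\<close>, the products with that entry force the same sign everywhere. This serves
  both the blockwise constraints of (QCQP) and the final uniqueness claim.\<close>

lemma outer_self_eq_iff: "outer v v = outer w w \<longleftrightarrow> v = w \<or> v = - w"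
proof
  assume eq: "outer v v = outer w w"
  have prods: "v $ i * v $ j = w $ i * w $ j" for i j
    using arg_cong[OF eq, of "\<lambda>M. M $ i $ j"] by (simp add: outer_def)
  show "v = w \<or> v = - w"
  proof (cases "w = 0")
    case True
    then have "v $ i = 0" for i using prods[of i i] by simp
    then show ?thesis using True by (simp add: vec_eq_iff)
  next
    case False
    then obtain p where p: "w $ p \<noteq> 0" by (auto simp: vec_eq_iff)
    have "v $ p = w $ p \<or> v $ p = - w $ p"
      using prods[of p p] by (simp add: square_eq_iff)
    then show ?thesis
    proof
      assume "v $ p = w $ p"
      then have "v $ i = w $ i" for i using prods[of p i] p by simp
      then show ?thesis by (simp add: vec_eq_iff)
    next
      assume "v $ p = - w $ p"
      then have "w $ p * (v $ i + w $ i) = 0" for i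
        using prods[of p i] by (simp add: distrib_left)
      then have "v $ i = - w $ i" for i using p by (simp add: add_eq_0_iff2)
      then show ?thesis by (simp add: vec_eq_iff)
    qed
  qed
qed (auto simp: outer_def)

lemma transpose_outer: "transpose (outer x y) = outer y x"
  by (simp add: outer_def transpose_def vec_eq_iff mult.commute)

lemma outer_scaleR: "outer (c *\<^sub>R x) (d *\<^sub>R y) = (c * d) *\<^sub>R outer x y"
  by (simp add: outer_def vec_eq_iff)

lemma trace_outer: "trace (outer x x) = x \<bullet> x"
  by (simp add: trace_def outer_def inner_vec_def)

lemma outer_mult_vec: "outer x y *v z = (y \<bullet> z) *\<^sub>R x"
  by (simp add: outer_def matrix_vector_mult_def inner_vec_def vec_eq_iff
      sum_distrib_right sum_distrib_left mult_ac)

lemma pos_semidef_outer: "pos_semidef (outer x x)"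
  by (simp add: pos_semidef_def transpose_outer outer_mult_vec inner_commute)

lemma trace_mult_outer: "trace (Q ** outer x x) = x \<bullet> (Q *v x)"
  by (simp add: trace_def outer_def matrix_matrix_mult_def matrix_vector_mult_def inner_vec_def
      sum_distrib_left mult_ac)

lemma mblk_outer: "mblk (outer x y) i j = outer (vblk x i) (vblk y j)"
  by (simp add: mblk_def outer_def vblk_def vec_eq_iff)

lemma qcqp_feasible_blocks:
  assumes "qcqp_feasible x"
  obtains \<theta> where "\<And>k. \<theta> k \<in> {1, -1}" "\<And>k. vblk x (Some k) = \<theta> k *\<^sub>R vblk x None"
proof -
  have "\<exists>t. t \<in> {1, -1::real} \<and> vblk x (Some k) = t *\<^sub>R vblk x None" for k
  proof -
    have "vblk x (Some k) = vblk x None \<or> vblk x (Some k) = - vblk x None"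
      using assms by (simp add: qcqp_feasible_def outer_self_eq_iff)
    then show ?thesis
      by (auto intro: exI[of _ 1] exI[of _ "-1"])
  qed
  then show thesis using that by metis
qed

text \<open>The trace and diagonal-block constraints match those of (QCQP) directly. What remains is
  symmetry of the off-diagonal blocks: it holds because all blocks of a (QCQP) point are
  parallel.\<close>

lemma sdp_feasible_outer_iff: "sdp_feasible (outer x x) \<longleftrightarrow> qcqp_feasible x"
proof
  assume "sdp_feasible (outer x x)"
  then show "qcqp_feasible x"
    by (simp add: sdp_feasible_def qcqp_feasible_def mblk_outer trace_outer)
next
  assume x: "qcqp_feasible x"
  obtain \<theta> where \<theta>: "\<And>k. vblk x (Some k) = \<theta> k *\<^sub>R vblk x None"
    using qcqp_feasible_blocks[OF x] by blast
  \<comment> \<open>Block 0 is included with factor 1, so that all pairs of blocks are treated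
    alike.\<close>
  have multiple: "\<exists>t. vblk x i = t *\<^sub>R vblk x None" for i
    using \<theta> by (cases i) (auto intro: exI[of _ 1])
  have "outer (vblk x i) (vblk x j) = outer (vblk x j) (vblk x i)" for i j
    using multiple[of i] multiple[of j] by (metis outer_scaleR mult.commute)
  then show "sdp_feasible (outer x x)"
    using x by (simp add: sdp_feasible_def qcqp_feasible_def mblk_outer trace_outer
        pos_semidef_outer transpose_outer)
qed

lemma sdp_cost_outer: "sdp_cost Q (outer x x) = qcqp_cost Q x"
  by (simp add: sdp_cost_def qcqp_cost_def trace_mult_outer)

text \<open>The row space has a basis of one vector \<open>v\<close>, and the entries of
  \<open>u\<close> are the coefficients of the rows along it.\<close>

lemma rank_one_factorization:
  fixes A :: "real^'n^'m"
  assumes "rank A = 1"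
  obtains u v where "A = outer u v"
proof -
  obtain B where B: "rows A \<subseteq> span B" "card B = 1"
    using basis_exists[of "rows A"] assms by (metis row_rank_def)
  obtain v where "B = {v}" using B(2) card_1_singletonE by blast
  then have "\<forall>i. \<exists>t. A $ i = t *\<^sub>R v"
    using B(1) by (fastforce simp: rows_def row_def span_singleton)
  then obtain u where "\<And>i. A $ i = u i *\<^sub>R v" by metis
  then have "A = outer (\<chi> i. u i) v" by (simp add: outer_def vec_eq_iff)
  then show thesis by (rule that)
qed

text \<open>The positive diagonal entry rules out matrices of the form
  \<open>- outer x x\<close>.\<close>

lemma symmetric_rank_one_eq_outer:
  fixes A :: "real^'n^'n"
  assumes sym: "transpose A = A" and "rank A = 1" and pos: "A $ p $ p > 0"
  obtains x where "A = outer x x"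
proof -
  obtain u v where A: "A = outer u v" using rank_one_factorization assms(2) by blast
  \<comment> \<open>If \<open>A = outer x x\<close>, column \<open>p\<close> is \<open>x $ p\<close>
    times \<open>x\<close> and \<open>A $ p $ p\<close> is the square of \<open>x $ p\<close>; this
    solves for \<open>x\<close> with \<open>x $ p\<close> positive.\<close>
  define x where "x = (\<chi> i. A $ i $ p / sqrt (A $ p $ p))"
  have "x $ i * x $ j = A $ i $ j" for i j
  proof -
    have "A $ i $ p * A $ p $ j = A $ i $ j * A $ p $ p" by (simp add: A outer_def)
    moreover have "A $ p $ j = A $ j $ p"
      using arg_cong[OF sym, of "\<lambda>M. M $ j $ p"] by (simp add: transpose_def)
    ultimately have "A $ i $ p * A $ j $ p = A $ i $ j * A $ p $ p" by simp
    then show ?thesis using pos by (simp add: x_def field_simps)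
  qed
  then have "A = outer x x" by (simp add: outer_def vec_eq_iff)
  then show thesis by (rule that)
qed

lemma sdp_feasible_rank_one:
  assumes Z: "sdp_feasible Z" and "rank Z = 1"
  obtains x where "Z = outer x x"
proof -
  \<comment> \<open>The trace normalization of block 0 supplies the positive diagonal entry.\<close>
  have "(\<Sum>r\<in>UNIV. Z $ (None, r) $ (None, r)) = 1"
    using Z by (simp add: sdp_feasible_def trace_def mblk_def)
  then have "\<not> (\<forall>r. Z $ (None, r) $ (None, r) \<le> 0)"
    using sum_nonpos[of UNIV "\<lambda>r. Z $ (None, r) $ (None, r)"] by auto
  then obtain r where "Z $ (None, r) $ (None, r) > 0" by (auto simp: not_le)
  moreover have "transpose Z = Z" using Z by (simp add: sdp_feasible_def pos_semidef_def)
  ultimately show thesis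
    using symmetric_rank_one_eq_outer[OF _ assms(2)] that by blast
qed

lemma INF_eq_of_is_arg_min:
  fixes f :: "'a \<Rightarrow> real"
  assumes "is_arg_min f P x"
  shows "(INF y\<in>{y. P y}. ereal (f y)) = ereal (f x)"
  using assms by (intro INF_eqI) (auto simp: is_arg_min_linorder)

text \<open>Uniqueness of the (SDP) optimum is the premise of the last conjunct, where it identifies
  the lift of any (QCQP) minimizer with \<open>Z\<close>.\<close>

theorem theorem13:
  fixes a b :: "'k::finite \<Rightarrow> real^3" and \<delta> :: "'k \<Rightarrow> real" and s c :: real
    and Q Z :: "'k block_mat"
  assumes "\<And>k. \<delta> k > 0" and "s > 0" and "c > 0"
    and "Q = data_matrix a b \<delta> s c"
    and "sdp_optimal Q Z"
    and "rank Z = 1"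
  shows "sdp_value Q = qcqp_value Q \<and>
    (\<exists>x. Z = outer x x \<and>
         (\<exists>q \<theta>. vblk x None = q \<and> (\<forall>k. \<theta> k \<in> {1, -1} \<and> vblk x (Some k) = \<theta> k *\<^sub>R q)) \<and>
         x \<noteq> - x \<and> qcqp_optimal Q x \<and> qcqp_optimal Q (- x) \<and>
         ((\<forall>Z'. sdp_optimal Q Z' \<longrightarrow> Z' = Z) \<longrightarrow> {y. qcqp_optimal Q y} = {x, - x}))"
proof -
  have Z: "sdp_feasible Z" and Z_le: "\<And>Y. sdp_feasible Y \<Longrightarrow> sdp_cost Q Z \<le> sdp_cost Q Y"
    using assms(5) by (auto simp: is_arg_min_linorder)
  obtain x where x: "Z = outer x x"
    using sdp_feasible_rank_one[OF Z assms(6)] by blast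
  have feas: "qcqp_feasible x" using Z x by (simp add: sdp_feasible_outer_iff)
  have opt: "qcqp_optimal Q x"
    \<comment> \<open>Every feasible point of (QCQP) lifts to one of (SDP) with the same cost, so
      \<open>Z_le\<close> bounds its cost from below by that of \<open>x\<close>.\<close>
    using feas Z_le x by (metis is_arg_min_linorder sdp_feasible_outer_iff sdp_cost_outer)
  have minus: "outer (- x) (- x) = outer x x" by (simp add: outer_self_eq_iff)
  have opt_minus: "qcqp_optimal Q (- x)"
    using opt minus by (metis is_arg_min_linorder sdp_feasible_outer_iff sdp_cost_outer)
  have "sdp_value Q = qcqp_value Q"
    unfolding sdp_value_def qcqp_value_def
    using INF_eq_of_is_arg_min[OF assms(5)] INF_eq_of_is_arg_min[OF opt]
    by (simp add: x sdp_cost_outer)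
  moreover have "x \<noteq> - x"
  proof
    assume "x = - x"
    then have "x $ i = 0" for i
      by (metis vector_uminus_component equal_neg_zero)
    \<comment> \<open>The zero vector violates the unit norm of block 0.\<close>
    then show False
      using feas by (simp add: qcqp_feasible_def vblk_def inner_vec_def)
  qed
  moreover have "\<exists>q \<theta>. vblk x None = q \<and> (\<forall>k. \<theta> k \<in> {1, -1} \<and> vblk x (Some k) = \<theta> k *\<^sub>R q)"
    using qcqp_feasible_blocks[OF feas] by metis
  moreover have "{y. qcqp_optimal Q y} = {x, - x}" if unique: "\<forall>Z'. sdp_optimal Q Z' \<longrightarrow> Z' = Z"
  proof -
    have "y = x \<or> y = - x" if y: "qcqp_optimal Q y" for y
    proof -
      have "qcqp_cost Q y \<le> qcqp_cost Q x"
        using y feas by (simp add: is_arg_min_linorder)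
      \<comment> \<open>The lift of \<open>y\<close> costs no more than \<open>Z\<close>, hence is
        itself optimal for (SDP).\<close>
      then have "sdp_cost Q (outer y y) \<le> sdp_cost Q Z"
        by (simp add: x sdp_cost_outer)
      then have "sdp_optimal Q (outer y y)"
        using y Z_le by (force simp: is_arg_min_linorder sdp_feasible_outer_iff)
      then have "outer y y = outer x x" using unique x by blast
      then show ?thesis by (simp add: outer_self_eq_iff)
    qed
    then show ?thesis using opt opt_minus by auto
  qed
  ultimately show ?thesis using x opt opt_minus by blast
qed

end
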